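(* Let $S$ be a numerical semigroup with multiplicity $3$ and Kunz-coordinates vector $x=(x_1,x_2)\in\mathbb{N}^2$. Then $S$ is irreducible if and only if one of the following conditions holds: \begin{enumerate} \item $x_1=x_2=1$; \item $2x_1\ge x_2+2$ and $2x_2\le x_1$; \item $2x_2\ge x_1+1$ and $2x_1\le x_2+1$. \end{enumerate}
   Context: $\mathbb{N}$ denotes the set of non-negative integers. A numerical semigroup is a subset $S\subseteq\mathbb{N}$ that is closed under addition, contains $0$ and has finite complement $\mathbb{N}\setminus S$. The multiplicity of $S$ is the smallest positive integer belonging to $S$. If $S$ has multiplicity $m$, let $w_i$ be the least element of $S$ congruent to $i$ modulo $m$, for $i=1,\dots,m-1$; the Kunz-coordinates vector of $S$ is $x=(x_1,\dots,x_{m-1})\in\mathbb{N}^{m-1}$ with $x_i=(w_i-i)/m$. A numerical semigroup is irreducible if it cannot be expressed as an intersection of two numerical semigroups containing it properly. *)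

theory Defs
  imports "HOL-Number_Theory.Cong"
begin

definition numerical_semigroup :: "nat set \<Rightarrow> bool" where
  "numerical_semigroup S \<longleftrightarrow>
     0 \<in> S \<and> (\<forall>a\<in>S. \<forall>b\<in>S. a + b \<in> S) \<and> finite (- S)"

definition semigroup_multiplicity :: "nat set \<Rightarrow> nat" where
  "semigroup_multiplicity S = (LEAST n. 0 < n \<and> n \<in> S)"

definition least_congruent :: "nat set \<Rightarrow> nat \<Rightarrow> nat" where
  "least_congruent S i = (LEAST w. w \<in> S \<and> [w = i] (mod semigroup_multiplicity S))"

text \<open>
  For a numerical semigroup and an index below its multiplicity, the least element of the
  residue class of the index is at least the index. Hence the subtraction below does not truncate,
  and the division is exact.
\<close>

definition kunz_coordinate :: "nat set \<Rightarrow> nat \<Rightarrow> nat" where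
  "kunz_coordinate S i = (least_congruent S i - i) div semigroup_multiplicity S"

text \<open>The vector is a list because its length depends on the semigroup.\<close>

definition kunz_vector :: "nat set \<Rightarrow> nat list" where
  "kunz_vector S = map (kunz_coordinate S) [1..<semigroup_multiplicity S]"

definition irreducible_semigroup :: "nat set \<Rightarrow> bool" where
  "irreducible_semigroup S \<longleftrightarrow> numerical_semigroup S \<and>
     \<not> (\<exists>T U. numerical_semigroup T \<and> numerical_semigroup U \<and>
          S \<subset> T \<and> S \<subset> U \<and> S = T \<inter> U)"

end

theory Submission imports Defs begin

text \<open>
  A numerical semigroup containing 3 is closed under adding 3, so it is the union of the multiples
  of 3 and of two rays \<open>3a + 1, 3a + 4, \<dots>\<close> and \<open>3b + 2, 3b + 5, \<dots>\<close>. The pair \<open>(a, b)\<close> is therefore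
  a complete set of coordinates. The sum of two elements of one ray lies in the other residue class,
  and so closure under addition amounts to the two linear inequalities \<open>b \<le> 2a\<close> and
  \<open>a \<le> 2b + 1\<close>; call such pairs admissible. Inclusion is the reversed
  componentwise order of the coordinates, and intersection is the componentwise maximum.

  Irreducibility thus becomes a question on lattice points: can an admissible \<open>(a, b)\<close> be the maximum
  of two smaller admissible pairs? If \<open>(a - 1, b)\<close> and \<open>(a, b - 1)\<close> are both admissible, it is
  their maximum. If one of the two is not admissible, say \<open>(a - 1, b)\<close>, then no admissible pair
  strictly below \<open>(a, b)\<close> has second coordinate \<open>b\<close>, so neither does a maximum of two of them.
  Hence irreducibility means that \<open>2a \<le> b + 1\<close> or \<open>2b \<le> a\<close>. For multiplicity exactly 3 both
  coordinates are positive, and this disjunction unfolds to the three listed cases.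
\<close>

definition kunz_set3 :: "nat \<Rightarrow> nat \<Rightarrow> nat set" where
  "kunz_set3 a b = {n. (n mod 3 = 1 \<longrightarrow> 3 * a + 1 \<le> n) \<and> (n mod 3 = 2 \<longrightarrow> 3 * b + 2 \<le> n)}"

lemma mem_kunz_set3_iffs:
  "3 * n + 1 \<in> kunz_set3 a b \<longleftrightarrow> a \<le> n" "3 * n + 2 \<in> kunz_set3 a b \<longleftrightarrow> b \<le> n"
proof -
  have "(3 * n + 1) mod 3 = 1" "(3 * n + 2) mod 3 = 2" by presburger+
  then show "3 * n + 1 \<in> kunz_set3 a b \<longleftrightarrow> a \<le> n" "3 * n + 2 \<in> kunz_set3 a b \<longleftrightarrow> b \<le> n"
    unfolding kunz_set3_def by auto
qed

lemma kunz_set3_subset_iff: "kunz_set3 a b \<subseteq> kunz_set3 c d \<longleftrightarrow> c \<le> a \<and> d \<le> b"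
proof
  assume "kunz_set3 a b \<subseteq> kunz_set3 c d"
  then show "c \<le> a \<and> d \<le> b"
    by (metis mem_kunz_set3_iffs order_refl subsetD)
qed (auto simp: kunz_set3_def)

lemma kunz_set3_eq_iff: "kunz_set3 a b = kunz_set3 c d \<longleftrightarrow> a = c \<and> b = d"
  by (metis kunz_set3_subset_iff order_antisym order_refl)

lemma kunz_set3_Int: "kunz_set3 a b \<inter> kunz_set3 c d = kunz_set3 (max a c) (max b d)"
  unfolding kunz_set3_def by auto

text \<open>
  The two inequalities say that twice the generator \<open>3a + 1\<close> reaches the ray of \<open>3b + 2\<close>, and twice
  \<open>3b + 2\<close> reaches the ray of \<open>3a + 1\<close>. All other sums of two elements are harmless, since they
  stay in the ray of a summand or fall into the multiples of 3.
\<close>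

lemma numerical_semigroup_kunz_set3_iff:
  "numerical_semigroup (kunz_set3 a b) \<longleftrightarrow> b \<le> 2 * a \<and> a \<le> 2 * b + 1"
proof
  assume *: "numerical_semigroup (kunz_set3 a b)"
  have "3 * a + 1 \<in> kunz_set3 a b" "3 * b + 2 \<in> kunz_set3 a b"
    by (simp_all only: mem_kunz_set3_iffs order_refl)
  with * have "(3 * a + 1) + (3 * a + 1) \<in> kunz_set3 a b"
    and "(3 * b + 2) + (3 * b + 2) \<in> kunz_set3 a b"
    unfolding numerical_semigroup_def by blast+
  moreover have "(3 * a + 1) + (3 * a + 1) = 3 * (2 * a) + 2"
    and "(3 * b + 2) + (3 * b + 2) = 3 * (2 * b + 1) + 1"
    by simp_all
  ultimately show "b \<le> 2 * a \<and> a \<le> 2 * b + 1" by (metis mem_kunz_set3_iffs)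
next
  assume *: "b \<le> 2 * a \<and> a \<le> 2 * b + 1"
  have "x + y \<in> kunz_set3 a b" if "x \<in> kunz_set3 a b" "y \<in> kunz_set3 a b" for x y
  proof -
    have "x mod 3 = 0 \<or> x mod 3 = 1 \<or> x mod 3 = 2" "y mod 3 = 0 \<or> y mod 3 = 1 \<or> y mod 3 = 2"
      by presburger+
    moreover have "(x + y) mod 3 = (x mod 3 + y mod 3) mod 3" by presburger
    ultimately show ?thesis using that * unfolding kunz_set3_def by auto
  qed
  moreover have "finite (- kunz_set3 a b)"
    by (rule finite_subset[of _ "{..3 * a + 3 * b + 2}"]) (auto simp: kunz_set3_def)
  ultimately show "numerical_semigroup (kunz_set3 a b)"
    unfolding numerical_semigroup_def by (auto simp: kunz_set3_def)
qed

lemma numerical_semigroup_add_mult: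
  assumes "numerical_semigroup S" "m \<in> S" "n \<in> S"
  shows "n + m * k \<in> S"
proof (induction k)
  case (Suc k)
  then have "(n + m * k) + m \<in> S" using assms unfolding numerical_semigroup_def by blast
  then show ?case by (simp add: algebra_simps)
qed (use assms in simp)

lemma numerical_semigroup_meets_residue_class:
  assumes "numerical_semigroup S" "0 < m"
  shows "\<exists>w\<in>S. w mod m = i mod m"
proof -
  obtain N where N: "\<forall>n\<in>- S. n < N"
    using assms(1) unfolding numerical_semigroup_def by (auto simp: finite_nat_set_iff_bounded)
  have "N \<le> i + m * N" using assms(2) by (cases m) auto
  with N have "i + m * N \<in> S" by (metis ComplI not_le)
  then show ?thesis by (metis mod_mult_self2)
qed

text \<open>
  The least element of each residue class modulo 3 determines the whole class. The coordinates are
  written as quotients here, so that the same lemma covers semigroups of multiplicity below 3,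
  which occur among the semigroups containing a given one.
\<close>

lemma numerical_semigroup_eq_kunz_set3:
  assumes S: "numerical_semigroup S" and "3 \<in> S"
  shows "S = kunz_set3 ((LEAST w. w \<in> S \<and> w mod 3 = 1) div 3) ((LEAST w. w \<in> S \<and> w mod 3 = 2) div 3)"
    (is "S = kunz_set3 (?w 1 div 3) (?w 2 div 3)")
proof -
  have least: "?w i \<in> S \<and> ?w i mod 3 = i" "\<And>n. n \<in> S \<Longrightarrow> n mod 3 = i \<Longrightarrow> ?w i \<le> n" if "i < 3" for i
  proof -
    obtain w where "w \<in> S \<and> w mod 3 = i"
      using numerical_semigroup_meets_residue_class[OF S, of 3 i] mod_less[OF \<open>i < 3\<close>] by auto
    then show "?w i \<in> S \<and> ?w i mod 3 = i" by (rule LeastI)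
  qed (auto intro: Least_le)
  have up: "n \<in> S" if "w \<in> S" "w mod 3 = n mod 3" "w \<le> n" for n w
  proof -
    have "3 dvd n - w" using that(2,3) by (metis mod_eq_dvd_iff_nat)
    then have "w + 3 * ((n - w) div 3) = n" using that(3) by simp
    then show ?thesis
      using numerical_semigroup_add_mult[OF S \<open>3 \<in> S\<close> that(1), of "(n - w) div 3"] by simp
  qed
  have class_iff: "n \<in> S \<longleftrightarrow> ?w (n mod 3) \<le> n" for n
    using least[of "n mod 3"] up[of "?w (n mod 3)" n] by auto
  have "0 \<in> S" using S unfolding numerical_semigroup_def by simp
  define c d where "c = ?w 1 div 3" and "d = ?w 2 div 3"
  have w: "?w 1 = 3 * c + 1" "?w 2 = 3 * d + 2"
    using least(1)[of 1] least(1)[of 2] mult_div_mod_eq[of 3 "?w 1"] mult_div_mod_eq[of 3 "?w 2"]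
    unfolding c_def d_def by simp_all
  have "n \<in> S \<longleftrightarrow> n \<in> kunz_set3 c d" for n
  proof -
    have "n mod 3 = 0 \<or> n mod 3 = 1 \<or> n mod 3 = 2" by presburger
    then show ?thesis
    proof (elim disjE)
      assume "n mod 3 = 0"
      then show ?thesis using up[OF \<open>0 \<in> S\<close>, of n] by (simp add: kunz_set3_def)
    next
      assume "n mod 3 = 1"
      with class_iff[of n] w(1) show ?thesis by (simp add: kunz_set3_def)
    next
      assume "n mod 3 = 2"
      with class_iff[of n] w(2) show ?thesis by (simp add: kunz_set3_def)
    qed
  qed
  then show ?thesis unfolding c_def d_def by blast
qed

text \<open>
  The right-hand side says that one of the pairs \<open>(a - 1, b)\<close> and \<open>(a, b - 1)\<close> violates the
  inequalities characterising semigroups.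
\<close>

lemma irreducible_kunz_set3_iff:
  assumes adm: "b \<le> 2 * a" "a \<le> 2 * b + 1"
  shows "irreducible_semigroup (kunz_set3 a b) \<longleftrightarrow> 2 * a \<le> b + 1 \<or> 2 * b \<le> a"
proof
  assume irr: "irreducible_semigroup (kunz_set3 a b)"
  show "2 * a \<le> b + 1 \<or> 2 * b \<le> a"
  proof (rule ccontr)
    assume *: "\<not> (2 * a \<le> b + 1 \<or> 2 * b \<le> a)"
    let ?T = "kunz_set3 (a - 1) b" and ?U = "kunz_set3 a (b - 1)"
    have "numerical_semigroup ?T" "numerical_semigroup ?U"
      using * adm unfolding numerical_semigroup_kunz_set3_iff by auto
    moreover have "kunz_set3 a b \<subset> ?T" "kunz_set3 a b \<subset> ?U"
      using * unfolding psubset_eq kunz_set3_subset_iff kunz_set3_eq_iff by auto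
    moreover have "kunz_set3 a b = ?T \<inter> ?U" by (simp add: kunz_set3_Int)
    ultimately show False using irr unfolding irreducible_semigroup_def by blast
  qed
next
  assume *: "2 * a \<le> b + 1 \<or> 2 * b \<le> a"
  have above: "\<exists>c d. T = kunz_set3 c d \<and> c \<le> a \<and> d \<le> b \<and> (c, d) \<noteq> (a, b) \<and> d \<le> 2 * c \<and> c \<le> 2 * d + 1"
    if T: "numerical_semigroup T" "kunz_set3 a b \<subset> T" for T
  proof -
    have "3 \<in> kunz_set3 a b" by (simp add: kunz_set3_def)
    then have "3 \<in> T" using T(2) by blast
    then obtain c d where "T = kunz_set3 c d"
      using numerical_semigroup_eq_kunz_set3[OF T(1)] by blast
    with T show ?thesis
      unfolding psubset_eq
      by (auto simp: kunz_set3_subset_iff kunz_set3_eq_iff numerical_semigroup_kunz_set3_iff)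
  qed
  have False if sgT: "numerical_semigroup T" "kunz_set3 a b \<subset> T"
    and sgU: "numerical_semigroup U" "kunz_set3 a b \<subset> U"
    and Int: "kunz_set3 a b = T \<inter> U" for T U
  proof -
    obtain c d where T: "T = kunz_set3 c d" "c \<le> a" "d \<le> b" "(c, d) \<noteq> (a, b)" "d \<le> 2 * c" "c \<le> 2 * d + 1"
      using above[OF sgT] by blast
    obtain e f where U: "U = kunz_set3 e f" "e \<le> a" "f \<le> b" "(e, f) \<noteq> (a, b)" "f \<le> 2 * e" "e \<le> 2 * f + 1"
      using above[OF sgU] by blast
    have "a = max c e" "b = max d f"
      using Int T(1) U(1) by (simp_all add: kunz_set3_Int kunz_set3_eq_iff)
    \<comment> \<open>If \<open>2 * a \<le> b + 1\<close>, then \<open>d = b\<close> would force \<open>c < a\<close> and \<open>b \<le> 2 * c \<le> 2 * a - 2 < b\<close>.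
      If \<open>2 * b \<le> a\<close>, then \<open>c = a\<close> would force \<open>d < b\<close> and \<open>a \<le> 2 * d + 1 \<le> 2 * b - 1 < a\<close>.\<close>
    moreover from * have "(d < b \<and> f < b) \<or> (c < a \<and> e < a)"
    proof
      assume "2 * a \<le> b + 1"
      then show ?thesis using T U by auto
    next
      assume "2 * b \<le> a"
      then show ?thesis using T U by auto
    qed
    ultimately show False by auto
  qed
  then show "irreducible_semigroup (kunz_set3 a b)"
    unfolding irreducible_semigroup_def using adm numerical_semigroup_kunz_set3_iff by blast
qed

lemma semigroup_multiplicity_props:
  assumes "numerical_semigroup S"
  shows "semigroup_multiplicity S \<in> S"
    and "\<And>n. n \<in> S \<Longrightarrow> 0 < n \<Longrightarrow> semigroup_multiplicity S \<le> n"
proof -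
  have "infinite S"
    using assms unfolding numerical_semigroup_def by (metis finite_compl infinite_UNIV_nat)
  then have "infinite (S - {0})" by simp
  then have "S - {0} \<noteq> {}" by (rule infinite_imp_nonempty)
  then obtain n where "n \<in> S - {0}" by blast
  then have "0 < n \<and> n \<in> S" by simp
  then have "0 < semigroup_multiplicity S \<and> semigroup_multiplicity S \<in> S"
    unfolding semigroup_multiplicity_def by (rule LeastI)
  then show "semigroup_multiplicity S \<in> S" by simp
qed (auto simp: semigroup_multiplicity_def intro: Least_le)

lemma eq_kunz_set3_kunz_vector:
  assumes S: "numerical_semigroup S" and m: "semigroup_multiplicity S = 3"
    and x: "kunz_vector S = [x1, x2]"
  shows "S = kunz_set3 x1 x2"
proof -
  have "3 \<in> S" using semigroup_multiplicity_props(1)[OF S] m by simp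
  have coordinate: "kunz_coordinate S i = (LEAST w. w \<in> S \<and> w mod 3 = i) div 3" if "i < 3" for i
  proof -
    let ?w = "LEAST w. w \<in> S \<and> w mod 3 = i"
    obtain w where "w \<in> S \<and> w mod 3 = i"
      using numerical_semigroup_meets_residue_class[OF S, of 3 i] mod_less[OF \<open>i < 3\<close>] by auto
    then have "?w mod 3 = i" by (rule LeastI2) simp
    then have "(?w - i) div 3 = ?w div 3"
      using minus_mod_eq_mult_div[of ?w 3] by simp
    moreover have "least_congruent S i = ?w"
      using that m by (simp add: least_congruent_def cong_def)
    ultimately show ?thesis using m by (simp add: kunz_coordinate_def)
  qed
  have "[1..<3] = [1, 2::nat]" by (simp add: upt_rec)
  then have "x1 = kunz_coordinate S 1" "x2 = kunz_coordinate S 2"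
    using x m by (simp_all add: kunz_vector_def)
  with coordinate[of 1] coordinate[of 2]
  have "x1 = (LEAST w. w \<in> S \<and> w mod 3 = 1) div 3" "x2 = (LEAST w. w \<in> S \<and> w mod 3 = 2) div 3"
    by simp_all
  then show ?thesis
    using numerical_semigroup_eq_kunz_set3[OF S \<open>3 \<in> S\<close>] by metis
qed

theorem theorem11:
  fixes S :: "nat set" and x1 x2 :: nat
  assumes "numerical_semigroup S"
    and "semigroup_multiplicity S = 3"
    and "kunz_vector S = [x1, x2]"
  shows "irreducible_semigroup S \<longleftrightarrow>
      (x1 = 1 \<and> x2 = 1) \<or>
      (2 * x1 \<ge> x2 + 2 \<and> 2 * x2 \<le> x1) \<or>
      (2 * x2 \<ge> x1 + 1 \<and> 2 * x1 \<le> x2 + 1)"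
proof -
  have S: "S = kunz_set3 x1 x2"
    by (rule eq_kunz_set3_kunz_vector[OF assms])
  have adm: "x2 \<le> 2 * x1" "x1 \<le> 2 * x2 + 1"
    using assms(1) unfolding S numerical_semigroup_kunz_set3_iff by blast+
  have "1 \<notin> S" "2 \<notin> S"
    using semigroup_multiplicity_props(2)[OF assms(1), of 1]
      semigroup_multiplicity_props(2)[OF assms(1), of 2]
    unfolding assms(2) by linarith+
  then have "3 * 0 + 1 \<notin> kunz_set3 x1 x2" "3 * 0 + 2 \<notin> kunz_set3 x1 x2"
    unfolding S by (simp_all add: numeral_2_eq_2)
  then have "1 \<le> x1" "1 \<le> x2" unfolding mem_kunz_set3_iffs by linarith+
  with adm show ?thesis
    unfolding S irreducible_kunz_set3_iff[OF adm] by linarith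
qed

end
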